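(* For $m\ge 1$ and complex numbers $y_1,\dots,y_m$ let $B\big(\sum_{j=1}^m y_jz^j\big)$ denote the $m\times m$ lower triangular Toeplitz matrix $$B\Big(\sum_{j=1}^m y_jz^j\Big)=\begin{pmatrix} y_m & 0 & & \dots & 0\\ y_{m-1}&y_m&0&\dots& 0\\ \vdots & &\ddots &\ddots & \vdots\\ y_2&\dots&y_{m-1}&y_m&0\\ y_1&y_2&\dots&y_{m-1}&y_m\end{pmatrix}.$$ Then, for exponents $p_1,\dots,p_n$, $$\int\prod_{l=0}^{n-1}\det\Big(1+B\Big(\sum_{j=1}^{n-l}x_{l+j}z^j\Big)B\Big(\sum_{j=1}^{n-l}x_{l+j}z^j\Big)^{*}\Big)^{-p_{l+1}}d\lambda(x_1,\dots,x_n)$$ $$=\pi^n\,\frac 1{(p_1-1)}\,\frac 1{(2p_1+p_2-3)}\cdots\frac 1{(np_1+(n-1)p_2+\cdots+p_n-(2n-1))}.$$ In particular, if for a general power series $x=\sum x_jz^j$ we write $B_n(x)=B\big(\sum_{j=1}^n x_jz^j\big)$, then $$\frac 1{\det(1+B_n(x)B_n(x)^{*})^p}\,d\lambda(x_1,\dots,x_n)$$ is a finite measure if and only if $p>2-\frac1n$.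
   Context: The variables $x_1,\dots,x_n$ range over $\mathbb C$, $d\lambda$ denotes Lebesgue measure on $\mathbb C^n$, and $M^*$ denotes the conjugate transpose of a matrix $M$. *)

theory Defs
  imports "HOL-Analysis.Analysis" "HOL-Computational_Algebra.Formal_Power_Series"
    "Jordan_Normal_Form.Schur_Decomposition"
begin

text \<open>
  The matrix \<open>B (y\<^sub>1 z + \<dots> + y\<^sub>m z\<^sup>m)\<close>. The size \<open>m\<close> is an explicit argument, since it is the upper
  summation bound and not the degree (\<open>y\<^sub>m\<close> may vanish). Indices are 0-based, so the entry in row
  \<open>i\<close> and column \<open>j \<le> i\<close> is the coefficient \<open>y\<close> with index \<open>m - (i - j)\<close>.
\<close>

definition toeplitz_B :: "nat \<Rightarrow> complex poly \<Rightarrow> complex mat" where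
  "toeplitz_B m f = mat m m (\<lambda>(i, j). if j \<le> i then poly.coeff f (m - (i - j)) else 0)"

definition toeplitz_Bn :: "nat \<Rightarrow> complex fps \<Rightarrow> complex mat" where
  "toeplitz_Bn n x = toeplitz_B n (\<Sum>j=1..n. Polynomial.monom (fps_nth x j) j)"

text \<open>
  The determinant of \<open>1 + A A\<^sup>*\<close> is a real number \<open>\<ge> 1\<close>, because \<open>A A\<^sup>*\<close> is Hermitian and positive
  semidefinite; \<open>Re\<close> only changes its type, so that real powers of it can be formed with \<open>powr\<close>.
  The name \<open>det\<close> is qualified because HOL-Analysis has a determinant of its own.
\<close>

definition det_one_plus :: "complex mat \<Rightarrow> real" where
  "det_one_plus A = Re (Determinant.det (1\<^sub>m (dim_row A) + A * mat_adjoint A))"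

text \<open>
  Lebesgue measure on \<open>\<complex>\<^sup>n\<close>: points are functions \<open>x\<close> on \<open>{1..n}\<close> with coordinates \<open>x 1, \<dots>, x n\<close>,
  and \<open>lborel\<close> on the complex plane is area measure.
\<close>

definition lborel_Cn :: "nat \<Rightarrow> (nat \<Rightarrow> complex) measure" where
  "lborel_Cn n = (\<Pi>\<^sub>M j\<in>{1..n}. lborel)"

definition det_product :: "nat \<Rightarrow> (nat \<Rightarrow> real) \<Rightarrow> (nat \<Rightarrow> complex) \<Rightarrow> real" where
  "det_product n p x =
     (\<Prod>l=0..n-1. det_one_plus (toeplitz_B (n - l) (\<Sum>j=1..n-l. Polynomial.monom (x (l + j)) j))
        powr (- p (l + 1)))"

text \<open>
  The \<open>k\<close>-th denominator \<open>k p\<^sub>1 + (k - 1) p\<^sub>2 + \<dots> + p\<^sub>k - (2 k - 1)\<close>.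
\<close>

definition denom :: "(nat \<Rightarrow> real) \<Rightarrow> nat \<Rightarrow> real" where
  "denom p k = (\<Sum>j=1..k. (real k + 1 - real j) * p j) - (2 * real k - 1)"

end

(*
Put t_i = x_(n-i) and let D_m be the determinant of the leading m x m block of 1 + B B*, where B is
the lower triangular Toeplitz matrix with t_i on its i-th subdiagonal; the integrand is the product
of the powers D_n^(-p_1) D_(n-1)^(-p_2) ... D_1^(-p_n). Since B is Toeplitz, the block of size m + 1
is a rank one update, by (t_0, ..., t_m), of diag(1, block of size m). Two Schur complements give
    D_(m+1) = D_(m-1) |t_m - c|^2 + D_m^2 / D_(m-1)
with c depending on t_0, ..., t_(m-1) only. Integrating over t_m by means of
    int (a |z - c|^2 + d)^(-p) dz = pi / (p - 1) * a^(-1) * d^(1-p)   (infinite for p <= 1)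
turns the integral into one of the same type with one variable fewer and with exponents
2 p_1 + p_2 - 2, p_3 + 2 - p_1, p_4, ..., whose denominators are the remaining ones.
*)
theory Submission
  imports Defs
begin


section \<open>Determinants of block matrices\<close>

text \<open>Block LU factorisation: the second factor is unipotent except for the Schur complement
  in its lower right block. The inverse enters as an explicit matrix \<open>A'\<close>, so that no
  division is required of the entries.\<close>

lemma det_block_schur:
  fixes A :: "'a :: idom mat"
  assumes A: "A \<in> carrier_mat n n" and A': "A' \<in> carrier_mat n n" and inv: "A * A' = 1\<^sub>m n"
    and B: "B \<in> carrier_mat n m" and C: "C \<in> carrier_mat m n" and D: "D \<in> carrier_mat m m"
  shows "Determinant.det (four_block_mat A B C D) = Determinant.det A * Determinant.det (D - C * A' * B)"
proof -
  let ?X = "D - C * A' * B"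
  have X: "?X \<in> carrier_mat m m" using A' B C D by auto
  have AB: "A * (A' * B) = B"
    using assoc_mult_mat[OF A A' B] inv B by simp
  have CX: "C * (A' * B) + ?X = D"
    using A' B C D assoc_mult_mat[OF C A' B] by (intro eq_matI) auto
  have "four_block_mat A (0\<^sub>m n m) C (1\<^sub>m m) * four_block_mat (1\<^sub>m n) (A' * B) (0\<^sub>m m n) ?X
      = four_block_mat A B C D"
    by (subst mult_four_block_mat[OF A zero_carrier_mat C one_carrier_mat one_carrier_mat
          mult_carrier_mat[OF A' B] zero_carrier_mat X])
       (use A A' B C D X AB CX in \<open>simp add: left_mult_zero_mat[OF X] del: zero_carrier_mat\<close>)
  then have "Determinant.det (four_block_mat A B C D) =
      Determinant.det (four_block_mat A (0\<^sub>m n m) C (1\<^sub>m m)) *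
      Determinant.det (four_block_mat (1\<^sub>m n) (A' * B) (0\<^sub>m m n) ?X)"
    using A A' B C D X
    by (subst det_mult[symmetric, of _ "n + m"]) (auto intro!: four_block_carrier_mat)
  also have "Determinant.det (four_block_mat A (0\<^sub>m n m) C (1\<^sub>m m)) = Determinant.det A"
    using det_four_block_mat_upper_right_zero[OF A refl C one_carrier_mat] by simp
  also have "Determinant.det (four_block_mat (1\<^sub>m n) (A' * B) (0\<^sub>m m n) ?X) = Determinant.det ?X"
    using det_four_block_mat_lower_left_zero[OF one_carrier_mat mult_carrier_mat[OF A' B] refl X] by simp
  finally show ?thesis .
qed

text \<open>Multiplying by a unipotent block matrix moves the product \<open>B * C\<close> into a
  border. Afterwards Schur complements can be taken with respect to blocks of \<open>A\<close>
  instead of \<open>A + B * C\<close>.\<close>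

lemma det_add_mult:
  fixes A :: "'a :: idom mat"
  assumes A: "A \<in> carrier_mat n n" and B: "B \<in> carrier_mat n m" and C: "C \<in> carrier_mat m n"
  shows "Determinant.det (A + B * C) = Determinant.det (four_block_mat A B (- C) (1\<^sub>m m))"
proof -
  have C': "- C \<in> carrier_mat m n" using C by simp
  have ABC: "A + B * C \<in> carrier_mat n n" using A B C by simp
  have 1: "A + B * C + B * (- C) = A"
    using A B C by (intro eq_matI) auto
  have "four_block_mat (A + B * C) B (0\<^sub>m m n) (1\<^sub>m m) * four_block_mat (1\<^sub>m n) (0\<^sub>m n m) (- C) (1\<^sub>m m)
      = four_block_mat A B (- C) (1\<^sub>m m)"
    by (subst mult_four_block_mat[OF ABC B zero_carrier_mat one_carrier_mat one_carrier_mat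
          zero_carrier_mat C' one_carrier_mat])
       (use A B C C' ABC 1 in \<open>simp add: right_mult_zero_mat[OF ABC] del: zero_carrier_mat\<close>)
  then have "Determinant.det (four_block_mat A B (- C) (1\<^sub>m m)) =
      Determinant.det (four_block_mat (A + B * C) B (0\<^sub>m m n) (1\<^sub>m m)) *
      Determinant.det (four_block_mat (1\<^sub>m n) (0\<^sub>m n m) (- C) (1\<^sub>m m))"
    using A B C
    by (subst det_mult[symmetric, of _ "n + m"]) (auto intro!: four_block_carrier_mat)
  then show ?thesis
    using det_four_block_mat_lower_left_zero[OF ABC B refl one_carrier_mat]
      det_four_block_mat_upper_right_zero[OF one_carrier_mat refl C' one_carrier_mat]
    by simp
qed

lemma det_dim_two:
  assumes "A \<in> carrier_mat 2 2"
  shows "Determinant.det A = A $$ (0,0) * A $$ (1,1) - A $$ (0,1) * A $$ (1,0)"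
proof -
  have "Determinant.det (mat_delete A 0 j) = mat_delete A 0 j $$ (0,0)" for j
    using assms by (intro det_single) auto
  then show ?thesis
    using assms
    by (subst laplace_expansion_row[OF assms, of 0])
       (auto simp: cofactor_def mat_delete_def numeral_2_eq_2 lessThan_Suc)
qed

lemma det_nonzero_imp_right_inverse:
  fixes A :: "'a :: field mat"
  assumes "A \<in> carrier_mat n n" "Determinant.det A \<noteq> 0"
  obtains A' where "A' \<in> carrier_mat n n" "A * A' = 1\<^sub>m n"
  using det_non_zero_imp_unit[OF assms, of undefined] by (auto simp: Units_def ring_mat_def)


section \<open>Rank one updates of Hermitian matrices\<close>

lemma det_rank_one_update:
  fixes s :: "nat \<Rightarrow> nat \<Rightarrow> 'a :: idom"
  shows "Determinant.det (mat k k (\<lambda>(i, j). s i j + b i * c j)) =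
    Determinant.det (four_block_mat (mat k k (\<lambda>(i, j). s i j)) (mat k 1 (\<lambda>(i, j). b i))
      (mat 1 k (\<lambda>(i, j). - c j)) (1\<^sub>m 1))"
proof -
  have "mat k k (\<lambda>(i, j). s i j + b i * c j) =
      mat k k (\<lambda>(i, j). s i j) + mat k 1 (\<lambda>(i, j). b i) * mat 1 k (\<lambda>(i, j). c j)"
    by (intro eq_matI) (auto simp: scalar_prod_def)
  moreover have "- mat 1 k (\<lambda>(i, j). c j) = mat 1 k (\<lambda>(i, j). - c j)"
    by (intro eq_matI) auto
  ultimately show ?thesis
    using det_add_mult[of "mat k k (\<lambda>(i, j). s i j)" k "mat k 1 (\<lambda>(i, j). b i)" 1 "mat 1 k (\<lambda>(i, j). c j)"]
    by simp
qed

text \<open>The conjugate transpose of \<open>A'\<close> is a left inverse of the Hermitian matrix,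
  and a left inverse coincides with a right inverse.\<close>

lemma hermitian_right_inverse:
  assumes herm: "\<And>i j. s i j = cnj (s j i)"
    and A': "A' \<in> carrier_mat m m" and inv: "mat m m (\<lambda>(i, j). s i j) * A' = 1\<^sub>m m"
    and ij: "i < m" "j < m"
  shows "cnj (A' $$ (i, j)) = A' $$ (j, i)"
proof -
  let ?A = "mat m m (\<lambda>(i, j). s i j)"
  define H where "H = mat m m (\<lambda>(i, j). cnj (A' $$ (j, i)))"
  have H: "H \<in> carrier_mat m m" by (simp add: H_def)
  have A: "?A \<in> carrier_mat m m" by simp
  have "(H * ?A) $$ (i, j) = 1\<^sub>m m $$ (i, j)" if "i < m" "j < m" for i j
  proof -
    have "(H * ?A) $$ (i, j) = cnj ((?A * A') $$ (j, i))"
      using that A' by (auto simp: H_def scalar_prod_def mult.commute herm[symmetric] intro!: sum.cong)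
    then show ?thesis using inv that by simp
  qed
  then have HA: "H * ?A = 1\<^sub>m m"
    using H by (intro eq_matI) auto
  have "H = H * (?A * A')" using inv H by simp
  also have "\<dots> = A'" using assoc_mult_mat[OF H A A'] HA A' by simp
  finally have "H $$ (j, i) = A' $$ (j, i)" by simp
  then show ?thesis using ij by (simp add: H_def)
qed

text \<open>Each determinant is \<open>E m\<close> times the determinant of a Schur complement of
  the leading block of \<open>s\<close>. For \<open>G b' (Suc m)\<close> this complement is 2 by 2,
  indexed by the row \<open>m\<close> and the border: its diagonal entries produce
  \<open>E (Suc m) * G b m\<close>, and its off-diagonal entries are conjugate up to sign, which
  produces the squared modulus.\<close>

lemma det_hermitian_rank_one_step:
  fixes s :: "nat \<Rightarrow> nat \<Rightarrow> complex" and b :: "nat \<Rightarrow> complex" and m :: nat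
  defines "E \<equiv> \<lambda>k. Determinant.det (mat k k (\<lambda>(i, j). s i j))"
    and "G \<equiv> \<lambda>b k. Determinant.det (mat k k (\<lambda>(i, j). s i j + b i * cnj (b j)))"
  assumes herm: "\<And>i j. s i j = cnj (s j i)" and nz: "E m \<noteq> 0"
  shows "\<exists>c. \<forall>b'. (\<forall>i<m. b' i = b i) \<longrightarrow>
    E m * G b' (Suc m) = (E m)\<^sup>2 * ((b' m - c) * cnj (b' m - c)) + E (Suc m) * G b m"
proof -
  let ?A = "mat m m (\<lambda>(i, j). s i j)"
  have A: "?A \<in> carrier_mat m m" by simp
  obtain A' where A': "A' \<in> carrier_mat m m" and inv: "?A * A' = 1\<^sub>m m"
    using det_nonzero_imp_right_inverse[OF A] nz unfolding E_def by blast
  have herm': "cnj (A' $$ (i, j)) = A' $$ (j, i)" if "i < m" "j < m" for i j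
    using hermitian_right_inverse[OF herm A' inv that] .
  \<comment> \<open>\<open>W y w\<close> is the bilinear form of the inverse \<open>A'\<close>; the
    corrections in all the Schur complements below are values of it.\<close>
  define W where "W = (\<lambda>y w. \<Sum>k = 0..<m. (\<Sum>l = 0..<m. y l * A' $$ (l, k)) * w k)"
  have W: "(mat p m (\<lambda>(i, j). y i j) * A' * mat m p (\<lambda>(i, j). w j i)) $$ (i, j) = W (y i) (w j)"
    if "i < p" "j < p" for p y w i j
    using that A' by (simp add: W_def scalar_prod_def)
  have F1: "E (Suc m) = E m * (s m m - W (s m) (\<lambda>i. s i m))"
  proof -
    have "mat (Suc m) (Suc m) (\<lambda>(i, j). s i j) =
        four_block_mat ?A (mat m 1 (\<lambda>(i, j). s i m)) (mat 1 m (\<lambda>(i, j). s m j)) (mat 1 1 (\<lambda>_. s m m))"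
      by (intro eq_matI) (auto simp: less_Suc_eq)
    then have "E (Suc m) = E m * Determinant.det
        (mat 1 1 (\<lambda>_. s m m) - mat 1 m (\<lambda>(i, j). s m j) * A' * mat m 1 (\<lambda>(i, j). s i m))"
      using det_block_schur[OF A A' inv, of "mat m 1 (\<lambda>(i, j). s i m)" 1 "mat 1 m (\<lambda>(i, j). s m j)"
          "mat 1 1 (\<lambda>_. s m m)"]
      unfolding E_def by simp
    then show ?thesis
      using A' W[of 0 1 0 "\<lambda>_. s m" "\<lambda>_ i. s i m"] by (subst (asm) det_single) auto
  qed
  have F2: "G b m = E m * (1 + W (\<lambda>i. cnj (b i)) b)"
  proof -
    have "G b m = E m * Determinant.det
        (1\<^sub>m 1 - mat 1 m (\<lambda>(i, j). - cnj (b j)) * A' * mat m 1 (\<lambda>(i, j). b i))"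
      using det_block_schur[OF A A' inv, of "mat m 1 (\<lambda>(i, j). b i)" 1 "mat 1 m (\<lambda>(i, j). - cnj (b j))" "1\<^sub>m 1"]
      unfolding G_def E_def det_rank_one_update by simp
    moreover have "W (\<lambda>i. - cnj (b i)) b = - W (\<lambda>i. cnj (b i)) b"
      by (simp add: W_def sum_negf)
    ultimately show ?thesis
      using A' W[of 0 1 0 "\<lambda>_ j. - cnj (b j)" "\<lambda>_. b"] by (subst (asm) det_single) auto
  qed
  \<comment> \<open>\<open>W\<close> reads its arguments only below \<open>m\<close>, so one
    \<open>c\<close> serves every \<open>b'\<close> that agrees with \<open>b\<close> there.\<close>
  define c where "c = W (s m) b"
  have cnj_c: "W (\<lambda>i. cnj (b i)) (\<lambda>i. s i m) = cnj c"
  proof -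
    have "cnj c = (\<Sum>k = 0..<m. \<Sum>l = 0..<m. s l m * A' $$ (k, l) * cnj (b k))"
      by (auto simp: c_def W_def herm' sum_distrib_right cnj_sum herm[of m] intro!: sum.cong)
    also have "\<dots> = (\<Sum>l = 0..<m. \<Sum>k = 0..<m. s l m * A' $$ (k, l) * cnj (b k))"
      by (rule sum.swap)
    also have "\<dots> = W (\<lambda>i. cnj (b i)) (\<lambda>i. s i m)"
      by (auto simp: W_def sum_distrib_right intro!: sum.cong)
    finally show ?thesis by simp
  qed
  \<comment> \<open>Schur complement of the leading block of \<open>s\<close> in the bordered matrix \<open>[[s, b'], [- b'\<^sup>*, 1]]\<close>.\<close>
  have F3: "G b' (Suc m) = E m * ((s m m - W (s m) (\<lambda>i. s i m)) * (1 + W (\<lambda>i. cnj (b i)) b)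
      + (b' m - c) * cnj (b' m - c))" if b': "\<forall>i<m. b' i = b i" for b'
  proof -
    define B where "B = mat m 2 (\<lambda>(i, j). (if j = 0 then \<lambda>i. s i m else b) i)"
    define C where "C = mat 2 m (\<lambda>(i, j). (if i = 0 then s m else (\<lambda>j. - cnj (b j))) j)"
    define D where "D = mat 2 2 (\<lambda>(i, j). if i = 0 then (if j = 0 then s m m else b' m)
      else (if j = 0 then - cnj (b' m) else 1))"
    have "four_block_mat (mat (Suc m) (Suc m) (\<lambda>(i, j). s i j)) (mat (Suc m) 1 (\<lambda>(i, j). b' i))
        (mat 1 (Suc m) (\<lambda>(i, j). - cnj (b' j))) (1\<^sub>m 1) = four_block_mat ?A B C D"
      using b' by (intro eq_matI) (auto simp: B_def C_def D_def less_Suc_eq numeral_2_eq_2)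
    then have "G b' (Suc m) = Determinant.det (four_block_mat ?A B C D)"
      unfolding G_def det_rank_one_update by simp
    also have "\<dots> = E m * Determinant.det (D - C * A' * B)"
      unfolding E_def by (rule det_block_schur[OF A A' inv, of _ 2]) (auto simp: B_def C_def D_def)
    also have "Determinant.det (D - C * A' * B) =
        (s m m - W (s m) (\<lambda>i. s i m)) * (1 - W (\<lambda>i. - cnj (b i)) b) -
        (b' m - W (s m) b) * (- cnj (b' m) - W (\<lambda>i. - cnj (b i)) (\<lambda>i. s i m))"
    proof -
      have CAB: "(C * A' * B) $$ (i, j) = W (if i = 0 then s m else (\<lambda>j. - cnj (b j)))
          (if j = 0 then \<lambda>i. s i m else b)" if "i < 2" "j < 2" for i j
        unfolding B_def C_def by (rule W[OF that])
      define X where "X = C * A' * B"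
      have X: "X \<in> carrier_mat 2 2" "D \<in> carrier_mat 2 2"
        using A' by (auto simp: X_def B_def C_def D_def)
      have "X $$ (0, 0) = W (s m) (\<lambda>i. s i m)" "X $$ (0, 1) = W (s m) b"
        "X $$ (1, 0) = W (\<lambda>i. - cnj (b i)) (\<lambda>i. s i m)" "X $$ (1, 1) = W (\<lambda>i. - cnj (b i)) b"
        using CAB[of 0 0] CAB[of 0 1] CAB[of 1 0] CAB[of 1 1] unfolding X_def by auto
      then show ?thesis
        unfolding X_def[symmetric] using X by (subst det_dim_two) (auto simp: D_def)
    qed
    finally have *: "G b' (Suc m) = E m * (
        (s m m - W (s m) (\<lambda>i. s i m)) * (1 - W (\<lambda>i. - cnj (b i)) b) -
        (b' m - W (s m) b) * (- cnj (b' m) - W (\<lambda>i. - cnj (b i)) (\<lambda>i. s i m)))" .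
    have "W (\<lambda>i. - cnj (b i)) w = - W (\<lambda>i. cnj (b i)) w" for w
      by (simp add: W_def sum_negf)
    then show ?thesis
      unfolding * c_def[symmetric] by (simp add: cnj_c algebra_simps)
  qed
  show ?thesis
  proof (intro exI[of _ c] allI impI)
    fix b' assume "\<forall>i<m. b' i = b i"
    then show "E m * G b' (Suc m) = (E m)\<^sup>2 * ((b' m - c) * cnj (b' m - c)) + E (Suc m) * G b m"
      by (simp add: F3 F1 F2 algebra_simps power2_eq_square)
  qed
qed

section \<open>The recursion for the Toeplitz determinants\<close>

text \<open>
  The entry \<open>(i, j)\<close> of \<open>1 + B B\<^sup>*\<close>, where \<open>B\<close> has \<open>t i\<close> on its \<open>i\<close>-th subdiagonal. It does not
  depend on the size of \<open>B\<close>: with \<open>t i = x (n - i)\<close>, all the matrices of the theorem are leading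
  blocks of the same one.
\<close>

definition toeplitz_gram :: "(nat \<Rightarrow> complex) \<Rightarrow> nat \<Rightarrow> nat \<Rightarrow> complex" where
  "toeplitz_gram t i j = (if i = j then 1 else 0) + (\<Sum>l\<le>min i j. t (i - l) * cnj (t (j - l)))"

definition toeplitz_det :: "(nat \<Rightarrow> complex) \<Rightarrow> nat \<Rightarrow> complex" where
  "toeplitz_det t m = Determinant.det (mat m m (\<lambda>(i, j). toeplitz_gram t i j))"

lemma toeplitz_gram_Suc_Suc:
  "toeplitz_gram t (Suc i) (Suc j) = toeplitz_gram t i j + t (Suc i) * cnj (t (Suc j))"
  unfolding toeplitz_gram_def min_Suc_Suc sum.atMost_Suc_shift by simp

lemma cnj_toeplitz_gram: "cnj (toeplitz_gram t i j) = toeplitz_gram t j i"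
  by (auto simp: toeplitz_gram_def cnj_sum min.commute mult.commute intro!: sum.cong)

lemma toeplitz_det_cong:
  assumes "\<And>i. i < m \<Longrightarrow> t i = t' i"
  shows "toeplitz_det t m = toeplitz_det t' m"
  unfolding toeplitz_det_def toeplitz_gram_def
  by (intro arg_cong[of _ _ Determinant.det] eq_matI) (auto simp: assms)

text \<open>The truncated \<open>m - 1\<close> is intended: for \<open>m = 0\<close> it gives the factor \<open>toeplitz_det t 0 = 1\<close>.\<close>

lemma toeplitz_det_step_complex:
  assumes nz: "toeplitz_det t (m - 1) \<noteq> 0"
  shows "\<exists>c. \<forall>z. toeplitz_det t (m - 1) * toeplitz_det (t(m := z)) (Suc m) =
    (toeplitz_det t (m - 1))\<^sup>2 * ((z - c) * cnj (z - c)) + (toeplitz_det t m)\<^sup>2"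
proof -
  \<comment> \<open>The Toeplitz structure makes \<open>1 + B B\<^sup>*\<close> a rank one update of the block matrix \<open>diag(1, 1 + B' B'\<^sup>*)\<close>,
    where \<open>B'\<close> is one size smaller.\<close>
  define s where "s = (\<lambda>i j. case i of 0 \<Rightarrow> if j = 0 then 1 else 0 | Suc i' \<Rightarrow>
    (case j of 0 \<Rightarrow> 0 | Suc j' \<Rightarrow> toeplitz_gram t i' j'))"
  have herm: "s i j = cnj (s j i)" for i j
    by (auto simp: s_def cnj_toeplitz_gram split: nat.splits)
  have E_Suc: "Determinant.det (mat (Suc k) (Suc k) (\<lambda>(i, j). s i j)) = toeplitz_det t k" for k
  proof -
    have "mat (Suc k) (Suc k) (\<lambda>(i, j). s i j) =
        four_block_mat (1\<^sub>m 1) (0\<^sub>m 1 k) (0\<^sub>m k 1) (mat k k (\<lambda>(i, j). toeplitz_gram t i j))"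
      by (intro eq_matI) (auto simp: s_def split: nat.splits)
    then show ?thesis
      unfolding toeplitz_det_def by (simp add: det_four_block_mat_lower_left_zero[where n = 1 and m = k])
  qed
  have E: "Determinant.det (mat k k (\<lambda>(i, j). s i j)) = toeplitz_det t (k - 1)" for k
    by (cases k) (auto simp: E_Suc toeplitz_det_def)
  have gram: "toeplitz_gram (t(m := z)) i j = s i j + (t(m := z)) i * cnj ((t(m := z)) j)"
    if "i \<le> m" "j \<le> m" for i j z
  proof (cases "i = 0 \<or> j = 0")
    case True
    then have "min i j = 0" by auto
    then have "toeplitz_gram t' i j = (if i = j then 1 else 0) + t' i * cnj (t' j)" for t'
      by (simp add: toeplitz_gram_def)
    moreover have "s i j = (if i = j then 1 else 0)"
      using True by (cases i; cases j) (auto simp: s_def)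
    ultimately show ?thesis by simp
  next
    case False
    then obtain i' j' where ij: "i = Suc i'" "j = Suc j'" by (cases i; cases j) auto
    \<comment> \<open>Only indices up to \<open>i'\<close> and \<open>j'\<close> occur, and these
      are below \<open>m\<close>, so the new value at \<open>m\<close> is not seen.\<close>
    have "toeplitz_gram (t(m := z)) i' j' = toeplitz_gram t i' j'"
      unfolding toeplitz_gram_def using that ij by (intro arg_cong2[of _ _ _ _ "(+)"] sum.cong) auto
    then show ?thesis unfolding ij toeplitz_gram_Suc_Suc by (simp add: s_def)
  qed
  have G: "toeplitz_det (t(m := z)) k =
      Determinant.det (mat k k (\<lambda>(i, j). s i j + (t(m := z)) i * cnj ((t(m := z)) j)))"
    if "k \<le> Suc m" for k z
    unfolding toeplitz_det_def
    by (intro arg_cong[of _ _ Determinant.det] eq_matI) (use that gram in auto)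
  \<comment> \<open>The border by 1 lowers the size: \<open>E (Suc m)\<close> becomes
    \<open>toeplitz_det t m\<close>. The update raises it back: \<open>G t m\<close> is
    \<open>toeplitz_det t m\<close> as well, whence the square in the result.\<close>
  from det_hermitian_rank_one_step[of s m t, unfolded E, OF herm nz]
  obtain c where c: "\<forall>b'. (\<forall>i<m. b' i = t i) \<longrightarrow> toeplitz_det t (m - 1) *
      Determinant.det (mat (Suc m) (Suc m) (\<lambda>(i, j). s i j + b' i * cnj (b' j))) =
      (toeplitz_det t (m - 1))\<^sup>2 * ((b' m - c) * cnj (b' m - c)) + toeplitz_det t (Suc m - 1) *
      Determinant.det (mat m m (\<lambda>(i, j). s i j + t i * cnj (t j)))" ..
  show ?thesis
  proof (intro exI[of _ c] allI)
    fix z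
    have "toeplitz_det t m = Determinant.det (mat m m (\<lambda>(i, j). s i j + t i * cnj (t j)))"
      using G[of m "t m"] by simp
    then show "toeplitz_det t (m - 1) * toeplitz_det (t(m := z)) (Suc m) =
      (toeplitz_det t (m - 1))\<^sup>2 * ((z - c) * cnj (z - c)) + (toeplitz_det t m)\<^sup>2"
      using c[rule_format, of "t(m := z)"] G[of "Suc m" z] by (simp add: power2_eq_square)
  qed
qed

text \<open>Strong induction through the recursion itself: positivity of the two smaller
  determinants provides both the nonvanishing hypothesis of the step and the sign of its right-hand
  side.\<close>

lemma toeplitz_det_pos: "toeplitz_det t m \<in> \<real> \<and> 0 < Re (toeplitz_det t m)"
proof (induction m rule: less_induct)
  case (less m)
  show ?case
  proof (cases m)
    case 0
    then show ?thesis by (simp add: toeplitz_det_def)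
  next
    case (Suc k)
    define a where "a = Re (toeplitz_det t (k - 1))"
    define d where "d = Re (toeplitz_det t k)"
    have a: "toeplitz_det t (k - 1) = of_real a" "a > 0" and d: "toeplitz_det t k = of_real d" "d > 0"
      using less.IH[of "k - 1"] less.IH[of k] Suc by (auto simp: a_def d_def of_real_Re)
    \<comment> \<open>Taking the new value to be \<open>t k\<close> leaves \<open>t\<close>
      unchanged and turns the step into a statement about \<open>t\<close> itself.\<close>
    obtain c where "toeplitz_det t (k - 1) * toeplitz_det (t(k := t k)) (Suc k) =
      (toeplitz_det t (k - 1))\<^sup>2 * ((t k - c) * cnj (t k - c)) + (toeplitz_det t k)\<^sup>2"
      using toeplitz_det_step_complex[of t k] a by (metis less_irrefl of_real_eq_0_iff)
    then have "of_real a * toeplitz_det t m = of_real (a\<^sup>2 * (cmod (t k - c))\<^sup>2 + d\<^sup>2)"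
      unfolding complex_norm_square[symmetric] using Suc a d by simp
    then have "toeplitz_det t m = of_real ((a\<^sup>2 * (cmod (t k - c))\<^sup>2 + d\<^sup>2) / a)"
      using a(2) by (simp add: field_simps)
    moreover have "(a\<^sup>2 * (cmod (t k - c))\<^sup>2 + d\<^sup>2) / a > 0"
      using a(2) d(2) by (intro divide_pos_pos add_nonneg_pos) auto
    ultimately show ?thesis by simp
  qed
qed

definition toeplitz_detR :: "(nat \<Rightarrow> complex) \<Rightarrow> nat \<Rightarrow> real" where
  "toeplitz_detR t m = Re (toeplitz_det t m)"

lemma toeplitz_detR_pos: "toeplitz_detR t m > 0"
  and of_real_toeplitz_detR: "of_real (toeplitz_detR t m) = toeplitz_det t m"
  using toeplitz_det_pos[of t m] by (auto simp: toeplitz_detR_def)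

lemma toeplitz_detR_0 [simp]: "toeplitz_detR t 0 = 1"
  by (simp add: toeplitz_detR_def toeplitz_det_def)

lemma toeplitz_detR_cong:
  "(\<And>i. i < m \<Longrightarrow> t i = t' i) \<Longrightarrow> toeplitz_detR t m = toeplitz_detR t' m"
  unfolding toeplitz_detR_def using toeplitz_det_cong by metis

text \<open>As a function of the last variable the determinant is a real quadratic
  \<open>a * |z - c|^2 + d\<close> with positive coefficients that do not involve \<open>z\<close>;
  this is the form integrated below.\<close>

lemma toeplitz_detR_step:
  "\<exists>c. \<forall>z. toeplitz_detR (t(m := z)) (Suc m) =
    toeplitz_detR t (m - 1) * (cmod (z - c))\<^sup>2 + (toeplitz_detR t m)\<^sup>2 / toeplitz_detR t (m - 1)"
proof -
  let ?a = "toeplitz_detR t (m - 1)" and ?d = "toeplitz_detR t m"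
  have a: "?a > 0" by (rule toeplitz_detR_pos)
  then have "toeplitz_det t (m - 1) \<noteq> 0"
    by (metis less_irrefl of_real_eq_0_iff of_real_toeplitz_detR)
  then obtain c where c: "\<And>z. toeplitz_det t (m - 1) * toeplitz_det (t(m := z)) (Suc m) =
    (toeplitz_det t (m - 1))\<^sup>2 * ((z - c) * cnj (z - c)) + (toeplitz_det t m)\<^sup>2"
    using toeplitz_det_step_complex by blast
  show ?thesis
  proof (intro exI[of _ c] allI)
    fix z
    have "complex_of_real (?a * toeplitz_detR (t(m := z)) (Suc m)) =
        of_real (?a\<^sup>2 * (cmod (z - c))\<^sup>2 + ?d\<^sup>2)"
      using c[of z] unfolding complex_norm_square[symmetric] by (simp flip: of_real_toeplitz_detR)
    then have "?a * toeplitz_detR (t(m := z)) (Suc m) = ?a\<^sup>2 * (cmod (z - c))\<^sup>2 + ?d\<^sup>2"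
      by (simp only: of_real_eq_iff)
    then show "toeplitz_detR (t(m := z)) (Suc m) = ?a * (cmod (z - c))\<^sup>2 + ?d\<^sup>2 / ?a"
      using a by (simp add: field_simps power2_eq_square)
  qed
qed


section \<open>The integral over one complex variable\<close>

lemma nn_integral_quadratic_powr_gt1:
  fixes c :: complex
  assumes a: "a > 0" and d: "d > 0" and p: "p > 1"
  shows "(\<integral>\<^sup>+z. ennreal ((a * (cmod (z - c))\<^sup>2 + d) powr (- p)) \<partial>lborel)
    = ennreal (pi / ((p - 1) * a) * d powr (1 - p))"
proof -
  \<comment> \<open>Layer cake: \<open>h\<close> is minus the derivative of \<open>(a r + d) powr (- p)\<close>, and discs \<open>|z - c|\<^sup>2 \<le> r\<close> have area \<open>pi r\<close>.\<close>
  define h where "h = (\<lambda>r. p * a * (a * r + d) powr (- p - 1))"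
  have h_meas [measurable]: "h \<in> borel_measurable borel"
    unfolding h_def by measurable
  have h_nonneg: "h r \<ge> 0" for r
    using a p by (simp add: h_def)
  have pos: "a * r + d > 0" if "r \<ge> 0" for r
    using a d that by (intro add_nonneg_pos) auto
  have at_top: "filterlim (\<lambda>r. a * r + d) at_top at_top"
    using filterlim_tendsto_add_at_top[OF tendsto_const
        filterlim_tendsto_pos_mult_at_top[OF tendsto_const a filterlim_ident], of d]
    by (simp add: add.commute)
  have layer: "(\<integral>\<^sup>+r. ennreal (h r) * indicator {s..} r \<partial>lborel) = ennreal ((a * s + d) powr (- p))"
    if s: "s \<ge> 0" for s
  proof -
    have "(\<integral>\<^sup>+r. ennreal (h r) * indicator {s..} r \<partial>lborel) = ennreal (0 - (- ((a * s + d) powr (- p))))"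
    proof (rule nn_integral_FTC_atLeast[OF h_meas])
      fix r assume "s \<le> r"
      then have r: "a * r + d > 0" using pos s by simp
      show "((\<lambda>r. - ((a * r + d) powr (- p))) has_real_derivative h r) (at r)"
        using r by (auto simp: h_def intro!: derivative_eq_intros)
    next
      have "((\<lambda>r. (a * r + d) powr (- p)) \<longlongrightarrow> 0) at_top"
        using p by (intro tendsto_neg_powr at_top) auto
      from tendsto_minus[OF this] show "((\<lambda>r. - ((a * r + d) powr (- p))) \<longlongrightarrow> 0) at_top"
        by simp
    qed (rule h_nonneg)
    then show ?thesis by simp
  qed
  \<comment> \<open>Antiderivative of \<open>h r * (pi * r)\<close>, found by writing
    \<open>a * r\<close> as \<open>(a * r + d) - d\<close>. Both of its powers tend to 0 at infinity
    because \<open>p > 1\<close>.\<close>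
  define F where "F = (\<lambda>r. - pi / a * (p / (p - 1) * (a * r + d) powr (1 - p) - d * (a * r + d) powr (- p)))"
  have "(\<integral>\<^sup>+z. ennreal ((a * (cmod (z - c))\<^sup>2 + d) powr (- p)) \<partial>lborel) =
      (\<integral>\<^sup>+z. (\<integral>\<^sup>+r. ennreal (h r) * indicator {(cmod (z - c))\<^sup>2..} r \<partial>lborel) \<partial>lborel)"
    by (simp add: layer)
  also have "\<dots> = (\<integral>\<^sup>+z. (\<integral>\<^sup>+r. ennreal (h r) * (if (cmod (z - c))\<^sup>2 \<le> r then 1 else 0) \<partial>lborel) \<partial>lborel)"
    by (intro nn_integral_cong) (auto simp: indicator_def)
  also have "\<dots> = (\<integral>\<^sup>+r. (\<integral>\<^sup>+z. ennreal (h r) * (if (cmod (z - c))\<^sup>2 \<le> r then 1 else 0) \<partial>lborel) \<partial>lborel)"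
    by (rule pair_sigma_finite.Fubini'[OF pair_sigma_finite.intro[OF sigma_finite_lborel sigma_finite_lborel]])
       measurable
  also have "\<dots> = (\<integral>\<^sup>+r. ennreal (h r * (pi * r)) * indicator {0..} r \<partial>lborel)"
  proof (rule nn_integral_cong)
    fix r :: real
    show "(\<integral>\<^sup>+z. ennreal (h r) * (if (cmod (z - c))\<^sup>2 \<le> r then 1 else 0) \<partial>lborel) =
        ennreal (h r * (pi * r)) * indicator {0..} r"
    proof (cases "r \<ge> 0")
      case True
      have "(if (cmod (z - c))\<^sup>2 \<le> r then 1 else 0) = (indicator (cball c (sqrt r)) z :: ennreal)" for z
        using real_le_rsqrt[of "cmod (z - c)" r] True
        by (auto simp: indicator_def dist_norm norm_minus_commute real_le_rsqrt sqrt_ge_absD)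
      then have "(\<integral>\<^sup>+z. ennreal (h r) * (if (cmod (z - c))\<^sup>2 \<le> r then 1 else 0) \<partial>lborel) =
          ennreal (h r) * emeasure lborel (cball c (sqrt r))"
        by (simp add: nn_integral_cmult_indicator)
      also have "\<dots> = ennreal (h r * (pi * r))"
        using True h_nonneg by (simp add: emeasure_cball unit_ball_vol_2 ennreal_mult)
      finally show ?thesis using True by simp
    next
      case False
      then have "\<not> (cmod (z - c))\<^sup>2 \<le> r" for z
        by (meson order.trans zero_le_power2)
      then show ?thesis using False by simp
    qed
  qed
  also have "\<dots> = ennreal (0 - F 0)"
  proof (rule nn_integral_FTC_atLeast)
    show "(\<lambda>r. h r * (pi * r)) \<in> borel_measurable borel" by measurable
    fix r :: real assume r: "0 \<le> r"
    let ?w = "a * r + d"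
    have w: "?w > 0" using pos r by simp
    have "?w powr (- p) = ?w * ?w powr (- p - 1)"
      using w powr_add[of ?w 1 "- p - 1"] by simp
    then have "- pi / a * (p / (p - 1) * ((1 - p) * ?w powr (- p) * a) - d * (- p * ?w powr (- p - 1) * a)) = h r * (pi * r)"
      using a p by (simp add: h_def field_simps)
    moreover have "(F has_real_derivative - pi / a * (p / (p - 1) * ((1 - p) * ?w powr (- p) * a)
        - d * (- p * ?w powr (- p - 1) * a))) (at r)"
      unfolding F_def using w a p by (auto intro!: derivative_eq_intros)
    ultimately show "(F has_real_derivative h r * (pi * r)) (at r)" by simp
    show "0 \<le> h r * (pi * r)" using r h_nonneg by simp
  next
    have "((\<lambda>r. (a * r + d) powr (- p)) \<longlongrightarrow> 0) at_top" "((\<lambda>r. (a * r + d) powr (1 - p)) \<longlongrightarrow> 0) at_top"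
      using p by (auto intro!: tendsto_neg_powr at_top)
    then have "(F \<longlongrightarrow> - pi / a * (p / (p - 1) * 0 - d * 0)) at_top"
      unfolding F_def by (intro tendsto_intros)
    then show "(F \<longlongrightarrow> 0) at_top" by simp
  qed
  also have "0 - F 0 = pi / ((p - 1) * a) * d powr (1 - p)"
  proof -
    have "d powr (1 - p) = d * d powr (- p)"
      using d powr_add[of d 1 "- p"] by simp
    then show ?thesis using a p by (simp add: F_def field_simps)
  qed
  finally show ?thesis .
qed

lemma nn_integral_quadratic_powr:
  fixes c :: complex
  assumes a: "a > 0" and d: "d > 0"
  shows "(\<integral>\<^sup>+z. ennreal ((a * (cmod (z - c))\<^sup>2 + d) powr (- p)) \<partial>lborel)
    = (if p > 1 then ennreal (pi / ((p - 1) * a) * d powr (1 - p)) else \<infinity>)"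
proof (cases "p > 1")
  case True
  then show ?thesis using nn_integral_quadratic_powr_gt1[OF assms] by simp
next
  case False
  let ?I = "\<integral>\<^sup>+z. ennreal ((a * (cmod (z - c))\<^sup>2 + d) powr (- p)) \<partial>lborel"
  \<comment> \<open>Comparison with the exponents \<open>q > 1\<close>, whose integrals blow up as \<open>q\<close> tends to 1.\<close>
  define C where "C = pi * d powr (1 - p) / a"
  have C: "C > 0" using a d by (simp add: C_def)
  have lower: "ennreal (C / (q - 1)) \<le> ?I" if q: "q > 1" for q
  proof -
    have le: "d powr (q - p) * (w powr (- q)) \<le> w powr (- p)" if "w \<ge> d" for w
    proof -
      have "d powr (q - p) * w powr (- q) \<le> w powr (q - p) * w powr (- q)"
        using that d q False by (intro mult_right_mono powr_mono2) auto
      also have "\<dots> = w powr (- p)" using that d by (simp flip: powr_add)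
      finally show ?thesis .
    qed
    have "ennreal (C / (q - 1)) = ennreal (d powr (q - p)) * ennreal (pi / ((q - 1) * a) * d powr (1 - q))"
      using a d q by (simp add: C_def ennreal_mult[symmetric] powr_add[symmetric] field_simps)
    also have "\<dots> = (\<integral>\<^sup>+z. ennreal (d powr (q - p)) * ennreal ((a * (cmod (z - c))\<^sup>2 + d) powr (- q)) \<partial>lborel)"
      by (simp add: nn_integral_quadratic_powr_gt1[OF a d q] nn_integral_cmult)
    also have "\<dots> \<le> ?I"
      using a by (intro nn_integral_mono) (simp add: ennreal_mult[symmetric] le)
    finally show ?thesis .
  qed
  have "?I = \<infinity>"
  proof (rule ccontr)
    assume "?I \<noteq> \<infinity>"
    then obtain K where K: "K \<ge> 0" "?I = ennreal K" by (cases ?I) auto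
    \<comment> \<open>This choice of \<open>q\<close> makes the lower bound equal to
      \<open>K + 1\<close>.\<close>
    have "ennreal (C / ((1 + C / (K + 1)) - 1)) \<le> ?I"
      using C K(1) by (intro lower) simp
    then show False
      using C K by simp
  qed
  then show ?thesis using False by simp
qed


section \<open>Exponents and denominators after one integration\<close>

text \<open>
  Integrating out the variable of the largest determinant leaves a factor
  \<open>D m powr (2 - 2 * p 1) * D (m - 1) powr (p 1 - 2)\<close>, which amounts to the new exponents \<open>p'\<close>.
\<close>

lemma prod_powr_shift:
  fixes D :: "nat \<Rightarrow> real" and p :: "nat \<Rightarrow> real"
  assumes D0: "D 0 = 1" and pos: "\<And>i. D i > 0"
    and p': "\<And>j. p' j = p (j + 1) + (if j = 1 then 2 * p 1 - 2 else if j = 2 then 2 - p 1 else 0)"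
  shows "(\<Prod>i=1..m. D i powr (- p (m + 2 - i))) * (D m powr (2 - 2 * p 1) * D (m - 1) powr (p 1 - 2))
    = (\<Prod>i=1..m. D i powr (- p' (m + 1 - i)))"
proof -
  consider "m = 0" | "m = 1" | k where "m = Suc (Suc k)" by (metis One_nat_def nat.exhaust)
  then show ?thesis
  proof cases
    case 1
    then show ?thesis by (simp add: D0)
  next
    case 2
    have "D 1 powr (- p 2) * D 1 powr (2 - 2 * p 1) = D 1 powr (- p' 1)"
      by (simp add: p' algebra_simps numeral_2_eq_2 flip: powr_add)
    then show ?thesis using 2 by (simp add: D0 numeral_2_eq_2)
  next
    case 3
    have eq: "(\<Prod>i=1..k. D i powr (- p (m + 2 - i))) = (\<Prod>i=1..k. D i powr (- p' (m + 1 - i)))"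
      by (intro prod.cong) (auto simp: p' 3 Suc_diff_le)
    have "D m powr (- p' 1) = D m powr (- p 2) * D m powr (2 - 2 * p 1)"
      by (simp add: p' algebra_simps numeral_2_eq_2 flip: powr_add)
    moreover have "D (m - 1) powr (- p' 2) = D (m - 1) powr (- p 3) * D (m - 1) powr (p 1 - 2)"
      by (simp add: p' algebra_simps numeral_2_eq_2 numeral_3_eq_3 flip: powr_add)
    ultimately show ?thesis
      using eq by (simp add: 3 numeral_2_eq_2 numeral_3_eq_3)
  qed
qed

lemma denom_1: "denom p 1 = p 1 - 1"
  by (simp add: denom_def)

text \<open>The two corrections contribute
  \<open>k * (2 * p 1 - 2) + (k - 1) * (2 - p 1) = (k + 1) * p 1 - 2\<close>. This is the missing
  first term of \<open>denom p (k + 1)\<close> together with the change of the constant from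
  \<open>2 * k - 1\<close> to \<open>2 * k + 1\<close>.\<close>

lemma denom_shift:
  assumes p': "\<And>j. p' j = p (j + 1) + (if j = 1 then 2 * p 1 - 2 else if j = 2 then 2 - p 1 else 0)"
    and k: "k \<ge> 1"
  shows "denom p' k = denom p (k + 1)"
proof -
  have "(\<Sum>j=1..k. (real k + 1 - real j) * (if j = 1 then 2 * p 1 - 2 else if j = 2 then 2 - p 1 else 0)) =
      (\<Sum>j=1..k. if j = 1 then real k * (2 * p 1 - 2) else 0)
      + (\<Sum>j=1..k. if j = 2 then (real k - 1) * (2 - p 1) else 0)"
    unfolding sum.distrib[symmetric] by (intro sum.cong) auto
  also have "\<dots> = real k * (2 * p 1 - 2) + (real k - 1) * (2 - p 1)"
  \<comment> \<open>For \<open>k = 1\<close> the sum has no term with \<open>j = 2\<close>, but the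
    coefficient \<open>k - 1\<close> vanishes too.\<close>
  proof (cases "k = 1")
    case False
    then have "2 \<in> {1..k}" using k by auto
    then show ?thesis using k by simp
  qed simp
  finally have "denom p' k = (\<Sum>j=1..k. (real k + 1 - real j) * p (j + 1))
      + (real k * (2 * p 1 - 2) + (real k - 1) * (2 - p 1)) - (2 * real k - 1)"
    by (simp add: denom_def p' distrib_left sum.distrib)
  moreover have "(\<Sum>j=1..k + 1. (real (k + 1) + 1 - real j) * p j)
      = (real k + 1) * p 1 + (\<Sum>j=1..k. (real k + 1 - real j) * p (j + 1))"
  proof -
    have "sum f {1..Suc k} = f 1 + (\<Sum>j=1..k. f (Suc j))" for f :: "nat \<Rightarrow> real"
      by (induction k) auto
    from this[of "\<lambda>j. (real (k + 1) + 1 - real j) * p j"] show ?thesis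
      by (simp add: algebra_simps del: sum.cl_ivl_Suc)
  qed
  ultimately show ?thesis
    by (simp add: denom_def algebra_simps)
qed

section \<open>Integration by induction on the number of variables\<close>

text \<open>By the Leibniz formula the determinant is a polynomial in the coordinates
  \<open>x (n - i)\<close> with \<open>i < m\<close> and their conjugates.\<close>

lemma toeplitz_detR_measurable:
  assumes I: "\<And>i. i < m \<Longrightarrow> n - i \<in> I"
  shows "(\<lambda>x. toeplitz_detR (\<lambda>i. x (n - i)) m) \<in> borel_measurable (Pi\<^sub>M I (\<lambda>_. lborel))"
proof -
  have comp: "(\<lambda>x. x (n - i) :: complex) \<in> borel_measurable (Pi\<^sub>M I (\<lambda>_. lborel))" if "i < m" for i
    using measurable_component_singleton[OF I[OF that], of "\<lambda>_. lborel :: complex measure"] by simp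
  have cnj: "(\<lambda>x. cnj (x (n - i))) \<in> borel_measurable (Pi\<^sub>M I (\<lambda>_. lborel))" if "i < m" for i
    by (rule borel_measurable_continuous_on[OF _ comp[OF that]]) (intro continuous_intros)
  have gram: "(\<lambda>x. toeplitz_gram (\<lambda>i. x (n - i)) i j) \<in> borel_measurable (Pi\<^sub>M I (\<lambda>_. lborel))"
    if "i < m" "j < m" for i j
    unfolding toeplitz_gram_def
    by (intro borel_measurable_add borel_measurable_sum borel_measurable_times borel_measurable_const comp cnj)
       (use that in auto)
  have "Determinant.det (mat m m (\<lambda>(i, j). toeplitz_gram t i j)) =
      (\<Sum>\<pi>\<in>{\<pi>. \<pi> permutes {0..<m}}. signof \<pi> * (\<Prod>i = 0..<m. toeplitz_gram t i (\<pi> i)))" for t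
    unfolding Determinant.det_def by (auto intro!: sum.cong prod.cong dest: permutes_in_image)
  then have *: "(\<lambda>x. toeplitz_detR (\<lambda>i. x (n - i)) m) = (\<lambda>x. Re (\<Sum>\<pi>\<in>{\<pi>. \<pi> permutes {0..<m}}.
      signof \<pi> * (\<Prod>i = 0..<m. toeplitz_gram (\<lambda>i. x (n - i)) i (\<pi> i))))"
    unfolding toeplitz_detR_def toeplitz_det_def by simp
  have "(\<lambda>x. \<Sum>\<pi>\<in>{\<pi>. \<pi> permutes {0..<m}}.
      signof \<pi> * (\<Prod>i = 0..<m. toeplitz_gram (\<lambda>i. x (n - i)) i (\<pi> i)))
      \<in> borel_measurable (Pi\<^sub>M I (\<lambda>_. lborel))"
    by (intro borel_measurable_sum borel_measurable_times borel_measurable_const borel_measurable_prod gram)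
       (auto dest: permutes_in_image)
  then show ?thesis unfolding * by measurable
qed

text \<open>Induction on \<open>m\<close> for all exponents at once, since each integration changes
  them. The new variable \<open>x (n - m)\<close> enters only the largest determinant. Keeping the
  value infinity in the statement makes divergence part of the same induction.\<close>

lemma nn_integral_toeplitz_detR:
  assumes "m \<le> n"
  shows "(\<integral>\<^sup>+x. ennreal (\<Prod>i=1..m. toeplitz_detR (\<lambda>i. x (n - i)) i powr (- p (m + 1 - i)))
      \<partial>(Pi\<^sub>M {n - m + 1..n} (\<lambda>_. lborel))) =
    (if \<forall>k\<in>{1..m}. denom p k > 0 then ennreal (pi ^ m * (\<Prod>k=1..m. 1 / denom p k)) else \<infinity>)"
  using assms
proof (induction m arbitrary: p)
  case 0
  then show ?case by (simp add: PiM_empty)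
next
  case (Suc m)
  interpret product_sigma_finite "\<lambda>_ :: nat. lborel :: complex measure" ..
  let ?D = "\<lambda>m x. toeplitz_detR (\<lambda>i. x (n - i)) m"
  let ?M = "Pi\<^sub>M {n - m + 1..n} (\<lambda>_. lborel :: complex measure)"
  \<comment> \<open>The factors that are constant in the new variable; \<open>m + 2 - i\<close> is
    the exponent index \<open>Suc m + 1 - i\<close>.\<close>
  define P where "P = (\<lambda>x. \<Prod>i=1..m. ?D i x powr (- p (m + 2 - i)))"
  have P_pos: "P x > 0" for x
    unfolding P_def by (intro prod_pos) (simp add: less_imp_neq[OF toeplitz_detR_pos, symmetric])
  have I: "{n - Suc m + 1..n} = insert (n - m) {n - m + 1..n}" "n - m \<notin> {n - m + 1..n}"
    using Suc.prems by auto
  have meas: "?D i \<in> borel_measurable (Pi\<^sub>M (insert (n - m) {n - m + 1..n}) (\<lambda>_. lborel))" if "i \<le> Suc m" for i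
    using that Suc.prems by (intro toeplitz_detR_measurable) auto
  \<comment> \<open>As \<open>Suc m \<le> n\<close>, the index \<open>n - m\<close> is positive, so
    \<open>n - i = n - m\<close> forces \<open>i = m\<close> even where the subtraction
    truncates.\<close>
  have upd: "?D i (x(n - m := z)) = toeplitz_detR ((\<lambda>i. x (n - i))(m := z)) i" for i x z
    using Suc.prems by (intro arg_cong2[of _ _ _ _ toeplitz_detR]) (auto simp: fun_eq_iff)
  have upd_le: "?D i (x(n - m := z)) = ?D i x" if "i \<le> m" for i x z
    unfolding upd using that by (intro toeplitz_detR_cong) auto
  have inner: "(\<integral>\<^sup>+z. ennreal (\<Prod>i=1..Suc m. ?D i (x(n - m := z)) powr (- p (Suc m + 1 - i))) \<partial>lborel) =
      (if p 1 > 1 then ennreal (pi / (p 1 - 1)) *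
        ennreal (P x * (?D m x powr (2 - 2 * p 1) * ?D (m - 1) x powr (p 1 - 2))) else \<infinity>)" for x
  proof -
    let ?a = "?D (m - 1) x" and ?d = "?D m x"
    have a: "?a > 0" and d: "?d > 0" by (simp_all add: toeplitz_detR_pos)
    obtain c where c: "\<And>z. ?D (Suc m) (x(n - m := z)) = ?a * (cmod (z - c))\<^sup>2 + ?d\<^sup>2 / ?a"
      using toeplitz_detR_step[of "\<lambda>i. x (n - i)" m] unfolding upd by blast
    have split: "(\<Prod>i=1..Suc m. ?D i (x(n - m := z)) powr (- p (Suc m + 1 - i))) =
        P x * ?D (Suc m) (x(n - m := z)) powr (- p 1)" for z
      unfolding P_def by (simp add: upd_le del: fun_upd_apply cong: prod.cong_simp)
    have "(\<integral>\<^sup>+z. ennreal (\<Prod>i=1..Suc m. ?D i (x(n - m := z)) powr (- p (Suc m + 1 - i))) \<partial>lborel) =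
        (\<integral>\<^sup>+z. ennreal (P x) * ennreal ((?a * (cmod (z - c))\<^sup>2 + ?d\<^sup>2 / ?a) powr (- p 1)) \<partial>lborel)"
      unfolding split c using P_pos[of x] by (simp add: ennreal_mult)
    also have "\<dots> = ennreal (P x) * (if p 1 > 1
        then ennreal (pi / ((p 1 - 1) * ?a) * (?d\<^sup>2 / ?a) powr (1 - p 1)) else \<infinity>)"
      using a d by (simp add: nn_integral_cmult nn_integral_quadratic_powr)
    also have "\<dots> = (if p 1 > 1 then ennreal (pi / (p 1 - 1)) *
        ennreal (P x * (?d powr (2 - 2 * p 1) * ?a powr (p 1 - 2))) else \<infinity>)"
    proof (cases "p 1 > 1")
      case True
      have "(?d\<^sup>2 / ?a) powr (1 - p 1) / ?a = ?d powr (2 - 2 * p 1) * ?a powr (p 1 - 2)"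
      proof -
        have "(?d\<^sup>2) powr (1 - p 1) = ?d powr (2 - 2 * p 1)"
          using d by (simp add: powr_powr algebra_simps flip: powr_numeral)
        moreover have "?a powr (p 1 - 2) = 1 / (?a powr (1 - p 1) * ?a)"
          using a powr_add[of ?a "1 - p 1" 1] powr_minus_divide[of ?a "2 - p 1"] by simp
        ultimately show ?thesis using a d by (simp add: powr_divide)
      qed
      then have "P x * (pi / ((p 1 - 1) * ?a) * (?d\<^sup>2 / ?a) powr (1 - p 1)) =
          pi / (p 1 - 1) * (P x * (?d powr (2 - 2 * p 1) * ?a powr (p 1 - 2)))"
        using a True by (simp add: field_simps)
      then show ?thesis
        using True P_pos[of x] a by (simp add: ennreal_mult[symmetric])
    next
      case False
      then show ?thesis using P_pos[of x] by (simp add: ennreal_mult_top)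
    qed
    finally show ?thesis .
  qed
  have "(\<integral>\<^sup>+x. ennreal (\<Prod>i=1..Suc m. ?D i x powr (- p (Suc m + 1 - i)))
      \<partial>(Pi\<^sub>M {n - Suc m + 1..n} (\<lambda>_. lborel))) =
    (\<integral>\<^sup>+x. (\<integral>\<^sup>+z. ennreal (\<Prod>i=1..Suc m. ?D i (x(n - m := z)) powr (- p (Suc m + 1 - i))) \<partial>lborel) \<partial>?M)"
    unfolding I(1)
  proof (rule product_nn_integral_insert)
    show "(\<lambda>x. ennreal (\<Prod>i=1..Suc m. ?D i x powr (- p (Suc m + 1 - i))))
      \<in> borel_measurable (Pi\<^sub>M (insert (n - m) {n - m + 1..n}) (\<lambda>_. lborel))"
      by (intro measurable_compose[OF _ measurable_ennreal] borel_measurable_prod powr_real_measurable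
          meas borel_measurable_const) auto
  qed (use I(2) in auto)
  also have "\<dots> = (\<integral>\<^sup>+x. (if p 1 > 1 then ennreal (pi / (p 1 - 1)) *
      ennreal (P x * (?D m x powr (2 - 2 * p 1) * ?D (m - 1) x powr (p 1 - 2))) else \<infinity>) \<partial>?M)"
    by (simp only: inner)
  also have "\<dots> = (if \<forall>k\<in>{1..Suc m}. denom p k > 0
      then ennreal (pi ^ Suc m * (\<Prod>k=1..Suc m. 1 / denom p k)) else \<infinity>)"
  proof (cases "p 1 > 1")
    case True
    define p' where "p' = (\<lambda>j. p (j + 1) + (if j = 1 then 2 * p 1 - 2 else if j = 2 then 2 - p 1 else 0))"
    have shift: "denom p (Suc k) = denom p' k" if "k \<ge> 1" for k
      using denom_shift[of p' p k] that by (simp add: p'_def)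
    have ball: "(\<forall>k\<in>{1..Suc m}. denom p k > 0) \<longleftrightarrow> (\<forall>k\<in>{1..m}. denom p' k > 0)"
    proof -
      have *: "{1..Suc m} = insert 1 (Suc ` {1..m})" by (auto simp: image_Suc_atLeastAtMost)
      show ?thesis
        unfolding * using True shift denom_1[of p] by (simp del: image_Suc_atLeastAtMost)
    qed
    have prod: "(\<Prod>k=1..Suc m. 1 / denom p k) = 1 / (p 1 - 1) * (\<Prod>k=1..m. 1 / denom p' k)"
    proof -
      have "(\<Prod>k=1..Suc m. 1 / denom p k) = 1 / denom p 1 * (\<Prod>k=1..m. 1 / denom p (Suc k))"
      proof -
        have "prod f {1..Suc m} = f 1 * (\<Prod>j=1..m. f (Suc j))" for f :: "nat \<Rightarrow> real"
          by (induction m) auto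
        then show ?thesis .
      qed
      then show ?thesis using denom_1[of p] by (simp add: shift cong: prod.cong_simp)
    qed
    have P: "P x * (?D m x powr (2 - 2 * p 1) * ?D (m - 1) x powr (p 1 - 2)) =
        (\<Prod>i=1..m. ?D i x powr (- p' (m + 1 - i)))" for x
      unfolding P_def
      by (rule prod_powr_shift[of "\<lambda>m. ?D m x"]) (simp_all add: toeplitz_detR_pos p'_def)
    have D_meas: "(\<lambda>x. ennreal (\<Prod>i=1..m. ?D i x powr (- p' (m + 1 - i)))) \<in> borel_measurable ?M"
      by (intro measurable_compose[OF _ measurable_ennreal] borel_measurable_prod powr_real_measurable
          toeplitz_detR_measurable borel_measurable_const) (use Suc.prems in auto)
    have "(\<integral>\<^sup>+x. ennreal (pi / (p 1 - 1)) *
        ennreal (\<Prod>i=1..m. ?D i x powr (- p' (m + 1 - i))) \<partial>?M) =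
      ennreal (pi / (p 1 - 1)) * (if \<forall>k\<in>{1..m}. denom p' k > 0
        then ennreal (pi ^ m * (\<Prod>k=1..m. 1 / denom p' k)) else \<infinity>)"
      using Suc.prems by (subst nn_integral_cmult[OF D_meas], subst Suc.IH) auto
    also have "\<dots> = (if \<forall>k\<in>{1..Suc m}. denom p k > 0
        then ennreal (pi ^ Suc m * (\<Prod>k=1..Suc m. 1 / denom p k)) else \<infinity>)"
    proof (cases "\<forall>k\<in>{1..m}. denom p' k > 0")
      case pos: True
      then have "(\<Prod>k=1..m. 1 / denom p' k) \<ge> 0" by (intro prod_nonneg) (simp add: less_imp_le)
      then show ?thesis
        using True pos unfolding ball prod by (simp add: ennreal_mult[symmetric])
    next
      case False
      then show ?thesis using True unfolding ball if_not_P[OF False] by (simp add: ennreal_mult_top)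
    qed
    finally show ?thesis using True by (simp only: P if_True)
  next
    case False
    \<comment> \<open>The induction hypothesis exhibits a nonzero integral over \<open>?M\<close>.\<close>
    have "emeasure ?M (space ?M) \<noteq> 0"
    proof
      assume null: "emeasure ?M (space ?M) = 0"
      let ?f = "\<lambda>x. ennreal (\<Prod>i=1..m. ?D i x powr (- p (m + 1 - i)))"
      have "integral\<^sup>N ?M ?f \<le> (\<integral>\<^sup>+x. \<infinity> \<partial>?M)" by (intro nn_integral_mono) simp
      then have "integral\<^sup>N ?M ?f = 0" using null by simp
      moreover have "pi ^ m * (\<Prod>k=1..m. 1 / denom p k) > 0" if "\<forall>k\<in>{1..m}. denom p k > 0"
        using that by (intro mult_pos_pos prod_pos) auto
      ultimately show False
        using Suc.IH[of p] Suc.prems by (auto split: if_splits simp: ennreal_eq_0_iff not_le)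
    qed
    moreover have "\<not> (\<forall>k\<in>{1..Suc m}. denom p k > 0)"
      using False denom_1[of p] by force
    ultimately show ?thesis using False by (simp add: ennreal_top_mult)
  qed
  finally show ?case .
qed


section \<open>Return to the matrices of the theorem\<close>

text \<open>The \<open>i\<close>-th subdiagonal of the matrix of size \<open>n - l\<close> carries
  \<open>x (l + (n - l - i)) = x (n - i)\<close>, whatever \<open>l\<close> is. Since the matrix is
  lower triangular, the sum for an entry of the product stops at \<open>min i j\<close>.\<close>

lemma det_one_plus_toeplitz_B:
  assumes "l < n"
  shows "det_one_plus (toeplitz_B (n - l) (\<Sum>j=1..n-l. Polynomial.monom (x (l + j)) j))
    = toeplitz_detR (\<lambda>i. x (n - i)) (n - l)"
proof -
  define m where "m = n - l"
  let ?f = "\<Sum>j=1..m. Polynomial.monom (x (l + j)) j"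
  define B where "B = toeplitz_B m ?f"
  have entry: "B $$ (i, k) = (if k \<le> i then x (n - (i - k)) else 0)" if "i < m" "k < m" for i k
  proof -
    have "poly.coeff ?f (m - (i - k)) = x (l + (m - (i - k)))"
      using that by (simp add: coeff_sum sum.delta)
    moreover have "l + (m - (i - k)) = n - (i - k)"
      using that assms by (simp add: m_def)
    ultimately show ?thesis
      using that by (cases "k \<le> i") (simp_all add: B_def toeplitz_B_def)
  qed
  have dims: "B \<in> carrier_mat m m" "mat_adjoint B \<in> carrier_mat m m"
    by (auto simp: B_def toeplitz_B_def mat_adjoint_def)
  have adj: "mat_adjoint B $$ (k, j) = cnj (B $$ (j, k))" if "j < m" "k < m" for j k
    using that dims(1) by (simp add: mat_adjoint_def mat_of_rows_index)
  have "1\<^sub>m (dim_row B) + B * mat_adjoint B = mat m m (\<lambda>(i, j). toeplitz_gram (\<lambda>i. x (n - i)) i j)"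
  proof (rule eq_matI)
    fix i j assume "i < dim_row (mat m m (\<lambda>(i, j). toeplitz_gram (\<lambda>i. x (n - i)) i j))"
      "j < dim_col (mat m m (\<lambda>(i, j). toeplitz_gram (\<lambda>i. x (n - i)) i j))"
    then have ij: "i < m" "j < m" by auto
    have "(B * mat_adjoint B) $$ (i, j) = (\<Sum>k = 0..<m. B $$ (i, k) * mat_adjoint B $$ (k, j))"
      using dims ij by (simp add: scalar_prod_def)
    also have "\<dots> = (\<Sum>k = 0..<m. if k \<le> min i j then x (n - (i - k)) * cnj (x (n - (j - k))) else 0)"
      by (intro sum.cong) (use ij in \<open>auto simp: adj entry\<close>)
    also have "\<dots> = (\<Sum>k\<le>min i j. x (n - (i - k)) * cnj (x (n - (j - k))))"
      by (intro sum.mono_neutral_cong_right) (use ij in auto)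
    finally show "(1\<^sub>m (dim_row B) + B * mat_adjoint B) $$ (i, j) =
        mat m m (\<lambda>(i, j). toeplitz_gram (\<lambda>i. x (n - i)) i j) $$ (i, j)"
      using ij dims by (simp add: toeplitz_gram_def)
  qed (use dims in auto)
  then show ?thesis
    unfolding m_def[symmetric] B_def[symmetric] det_one_plus_def toeplitz_detR_def toeplitz_det_def by simp
qed

lemma det_product_eq:
  assumes "n \<ge> 1"
  shows "det_product n p x = (\<Prod>i=1..n. toeplitz_detR (\<lambda>i. x (n - i)) i powr (- p (n + 1 - i)))"
proof -
  have "det_product n p x = (\<Prod>l=0..n-1. toeplitz_detR (\<lambda>i. x (n - i)) (n - l) powr (- p (l + 1)))"
    unfolding det_product_def
    by (intro prod.cong arg_cong2[of _ _ _ _ "(powr)"] det_one_plus_toeplitz_B) (use assms in auto)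
  also have "\<dots> = (\<Prod>i=1..n. toeplitz_detR (\<lambda>i. x (n - i)) i powr (- p (n + 1 - i)))"
    by (rule prod.reindex_bij_witness[of _ "\<lambda>i. n - i" "\<lambda>l. n - l"]) (use assms in \<open>auto simp: Suc_diff_le\<close>)
  finally show ?thesis .
qed

lemma det_product_nonneg: "det_product n p x \<ge> 0"
  unfolding det_product_def by (intro prod_nonneg) simp

lemma det_product_measurable:
  assumes "n \<ge> 1"
  shows "det_product n p \<in> borel_measurable (lborel_Cn n)"
  unfolding det_product_eq[OF assms, abs_def] lborel_Cn_def
  by (intro borel_measurable_prod powr_real_measurable toeplitz_detR_measurable borel_measurable_const) auto

lemma nn_integral_det_product:
  assumes "n \<ge> 1"
  shows "(\<integral>\<^sup>+x. ennreal (det_product n p x) \<partial>lborel_Cn n) =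
    (if \<forall>k\<in>{1..n}. denom p k > 0 then ennreal (pi ^ n * (\<Prod>k=1..n. 1 / denom p k)) else \<infinity>)"
  using nn_integral_toeplitz_detR[of n n p] assms
  by (simp only: det_product_eq lborel_Cn_def) simp

lemma denom_single:
  assumes "k \<ge> 1"
  shows "denom (\<lambda>j. if j = 1 then p else 0) k = real k * p - (2 * real k - 1)"
proof -
  have "(\<Sum>j=1..k. (real k + 1 - real j) * (if j = 1 then p else 0)) = (\<Sum>j=1..k. if j = 1 then real k * p else 0)"
    by (intro sum.cong) auto
  then show ?thesis using assms by (simp add: denom_def)
qed

text \<open>The thresholds \<open>2 - 1 / k\<close> increase with \<open>k\<close>, so the condition
  for \<open>k = n\<close> implies all the others.\<close>

lemma denom_single_pos_iff:
  assumes "n \<ge> 1"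
  shows "(\<forall>k\<in>{1..n}. denom (\<lambda>j. if j = 1 then p else 0) k > 0) \<longleftrightarrow> p > 2 - 1 / real n"
proof -
  have pos: "denom (\<lambda>j. if j = 1 then p else 0) k > 0 \<longleftrightarrow> p > 2 - 1 / real k" if "k \<ge> 1" for k
    unfolding denom_single[OF that] using that by (simp add: field_simps)
  have "2 - 1 / real k \<le> 2 - 1 / real n" if "1 \<le> k" "k \<le> n" for k
    using that by (simp add: frac_le)
  then show ?thesis
    using assms pos by (metis atLeastAtMost_iff order.refl order.strict_trans1)
qed

theorem theorem1:
  fixes n :: nat
  assumes "n \<ge> 1"
  shows "(\<forall>p :: nat \<Rightarrow> real.
            (integrable (lborel_Cn n) (det_product n p) \<longleftrightarrow> (\<forall>k\<in>{1..n}. denom p k > 0)) \<and>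
            ((\<forall>k\<in>{1..n}. denom p k > 0) \<longrightarrow>
               (\<integral>x. det_product n p x \<partial>lborel_Cn n) = pi ^ n * (\<Prod>k=1..n. 1 / denom p k)))
       \<and> (\<forall>p :: real.
            finite_measure (density (lborel_Cn n)
              (\<lambda>x. ennreal (1 / det_one_plus (toeplitz_Bn n (Abs_fps x)) powr p)))
            \<longleftrightarrow> p > 2 - 1 / real n)"
proof (intro conjI allI)
  fix p :: "nat \<Rightarrow> real"
  let ?f = "det_product n p"
  note nn = nn_integral_det_product[OF assms, of p]
  show "integrable (lborel_Cn n) ?f \<longleftrightarrow> (\<forall>k\<in>{1..n}. denom p k > 0)"
    using det_product_measurable[OF assms] nn
    by (simp add: integrable_iff_bounded det_product_nonneg)
  show "(\<forall>k\<in>{1..n}. denom p k > 0) \<longrightarrow>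
      (\<integral>x. ?f x \<partial>lborel_Cn n) = pi ^ n * (\<Prod>k=1..n. 1 / denom p k)"
  proof
    assume pos: "\<forall>k\<in>{1..n}. denom p k > 0"
    then have "(\<Prod>k=1..n. 1 / denom p k) \<ge> 0" by (intro prod_nonneg) (simp add: less_imp_le)
    then have "enn2real (\<integral>\<^sup>+x. ennreal (?f x) \<partial>lborel_Cn n) = pi ^ n * (\<Prod>k=1..n. 1 / denom p k)"
      unfolding nn using pos by simp
    then show "(\<integral>x. ?f x \<partial>lborel_Cn n) = pi ^ n * (\<Prod>k=1..n. 1 / denom p k)"
      using det_product_measurable[OF assms] by (simp add: integral_eq_nn_integral det_product_nonneg)
  qed
next
  fix p :: real
  let ?p = "\<lambda>j::nat. if j = 1 then p else 0"
  let ?g = "\<lambda>x. ennreal (1 / det_one_plus (toeplitz_Bn n (Abs_fps x)) powr p)"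
  have D: "det_one_plus (toeplitz_Bn n (Abs_fps x)) = toeplitz_detR (\<lambda>i. x (n - i)) n" for x
    using det_one_plus_toeplitz_B[of 0 n x] assms by (simp add: toeplitz_Bn_def)
  have g: "?g x = ennreal (det_product n ?p x)" for x
  proof -
    \<comment> \<open>Exponent 0 yields the factor 1 only for a nonzero base, because
      \<open>0 powr 0 = 0\<close>; positivity of the determinants ensures this.\<close>
    have "det_product n ?p x = (\<Prod>i=1..n. if i = n then toeplitz_detR (\<lambda>i. x (n - i)) n powr (- p) else 1)"
      unfolding det_product_eq[OF assms]
      by (intro prod.cong) (auto simp: less_imp_neq[OF toeplitz_detR_pos, symmetric])
    then show ?thesis
      using assms by (simp add: D powr_minus_divide)
  qed
  have "emeasure (density (lborel_Cn n) ?g) (space (density (lborel_Cn n) ?g)) =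
      (\<integral>\<^sup>+x. ennreal (det_product n ?p x) \<partial>lborel_Cn n)"
    using det_product_measurable[OF assms, of ?p]
    by (simp add: g emeasure_density cong: nn_integral_cong_simp)
  then have "finite_measure (density (lborel_Cn n) ?g) \<longleftrightarrow>
      (\<integral>\<^sup>+x. ennreal (det_product n ?p x) \<partial>lborel_Cn n) \<noteq> \<infinity>"
    using finite_measure.emeasure_finite finite_measureI by (metis infinity_ennreal_def)
  then show "finite_measure (density (lborel_Cn n) ?g) \<longleftrightarrow> p > 2 - 1 / real n"
    unfolding nn_integral_det_product[OF assms] denom_single_pos_iff[OF assms] by simp
qed

end
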